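(* Let $\mathcal{A}$ be an abelian category with small $\operatorname{Ext}$ groups and $\mathcal{E}$ an exact structure on $\mathcal{A}$ such that $\mathcal{A}$ has enough $\mathcal{E}$-projectives and enough $\mathcal{E}$-injectives. Let $\mathcal{X}$ be a full subcategory of $\mathcal{A}$ closed under $\mathcal{E}$-extensions and let $A\in\mathcal{A}$. (1) If $f:X\to A$ is an epimorphic $\mathcal{X}$-cover, then $\operatorname{Ker} f\in\mathcal{X}^{\bot_{\ast}}$. (2) If $f:A\to X$ is a monomorphic $\mathcal{X}$-envelope, then $\operatorname{Coker} f\in{}^{\bot_{\ast}}\mathcal{X}$.
   Context: Small Ext groups: $\operatorname{Ext}^1_{\mathcal{A}}(X,Y)$ is a set for all $X,Y$. A subcategory of $\mathcal{A}$ means a full and additive subcategory closed under isomorphisms and direct summands. Exact structure: a kernel-cokernel pair $(i,p)$ is a composable pair $L\xrightarrow{i}M\xrightarrow{p}N$ with $i$ a kernel of $p$ and $p$ a cokernel of $i$. For a class $\mathcal{E}$ of such pairs, $i$ (resp. $p$) is an admissible monic (resp. admissible epic) if it is the first (resp. second) morphism of a pair in $\mathcal{E}$. $\mathcal{E}$ is an exact structure if it is closed under isomorphisms and: identities are both admissible monics and admissible epics; admissible monics (resp. epics) are closed under composition; push-outs of admissible monics along arbitrary morphisms exist and are admissible monics; pull-backs of admissible epics along arbitrary morphisms exist and are admissible epics. Elements of $\mathcal{E}$ are called conflations. $P$ is $\mathcal{E}$-projective if every morphism $P\to N$ lifts along every admissible epic $M\to N$; $I$ is $\mathcal{E}$-injective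 if every morphism $L\to I$ extends along every admissible monic $L\to M$. Enough $\mathcal{E}$-projectives (resp. $\mathcal{E}$-injectives): every object $M$ admits an admissible epic $P\to M$ with $P$ $\mathcal{E}$-projective (resp. an admissible monic $M\to I$ with $I$ $\mathcal{E}$-injective). $\mathcal{E}\mathrm{xt}^{i}_{\mathcal{A}}(M,N)$, $i\ge 1$, is the $i$-th cohomology group obtained by applying $\operatorname{Hom}_{\mathcal{A}}(-,N)$ to an $\mathcal{E}$-projective resolution of $M$ (built from conflations), or equivalently $\operatorname{Hom}_{\mathcal{A}}(M,-)$ to an $\mathcal{E}$-injective coresolution of $N$. Put $\mathcal{X}^{\bot_{\ast}}=\{N\in\mathcal{A}\mid \mathcal{E}\mathrm{xt}^1_{\mathcal{A}}(M,N)=0 \text{ for all } M\in\mathcal{X}\}$ and ${}^{\bot_{\ast}}\mathcal{X}=\{M\in\mathcal{A}\mid \mathcal{E}\mathrm{xt}^1_{\mathcal{A}}(M,N)=0\text{ for all }N\in\mathcal{X}\}$. $\mathcal{X}$ is closed under $\mathcal{E}$-extensions if whenever the end terms of a conflation are in $\mathcal{X}$, so is the middle term. An $\mathcal{X}$-precover of $A$ is a morphism $f:X\to A$ with $X\in\mathcal{X}$ such that every morphism $X'\to A$ with $X'\in\mathcal{X}$ factors through $f$; it is an $\mathcal{X}$-cover if moreover every endomorphism $h$ of $X$ with $f=fh$ is an automorphism. $\mathcal{X}$-(pre)envelopes $A\to X$ are defined dually. Epimorphic (resp. monomorphic) means that the morphism is an epimorphism (resp. monomorphism) in $\mathcal{A}$.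 *)

theory Defs
  imports "HOL-Algebra.Elementary_Groups"
begin

section \<open>Abelian categories\<close>

text \<open>
  Objects and morphisms live in arbitrary types \<open>'o\<close> and \<open>'m\<close>; every morphism has a unique
  domain and codomain, so distinct hom-sets are disjoint. Composition and addition are total
  functions, meaningful only on composable, respectively parallel, morphisms. As all collections of
  morphisms are sets of a HOL type, hom-sets and Ext groups are automatically sets.
\<close>

record ('o, 'm) preadditive_data =
  Obj :: "'o set"
  Arr :: "'m set"
  Dom :: "'m \<Rightarrow> 'o"
  Cod :: "'m \<Rightarrow> 'o"
  Id :: "'o \<Rightarrow> 'm"
  Comp :: "'m \<Rightarrow> 'm \<Rightarrow> 'm" (infixl "\<cdot>\<index>" 70)
  Add :: "'m \<Rightarrow> 'm \<Rightarrow> 'm" (infixl "\<boxplus>\<index>" 65)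
  Zero :: "'o \<Rightarrow> 'o \<Rightarrow> 'm"

definition Hom :: "('o, 'm, 'z) preadditive_data_scheme \<Rightarrow> 'o \<Rightarrow> 'o \<Rightarrow> 'm set" where
  "Hom C A B = {f \<in> Arr C. Dom C f = A \<and> Cod C f = B}"

definition hom_group :: "('o, 'm, 'z) preadditive_data_scheme \<Rightarrow> 'o \<Rightarrow> 'o \<Rightarrow> 'm monoid" where
  "hom_group C A B = \<lparr>carrier = Hom C A B, mult = Add C, one = Zero C A B\<rparr>"

locale preadditive_category =
  fixes C :: "('o, 'm, 'z) preadditive_data_scheme" (structure)
  assumes Dom_in_Obj: "f \<in> Arr C \<Longrightarrow> Dom C f \<in> Obj C"
    and Cod_in_Obj: "f \<in> Arr C \<Longrightarrow> Cod C f \<in> Obj C"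
    and Id_in_Hom: "A \<in> Obj C \<Longrightarrow> Id C A \<in> Hom C A A"
    and Comp_in_Hom: "\<lbrakk>f \<in> Hom C A B; g \<in> Hom C B D\<rbrakk> \<Longrightarrow> g \<cdot> f \<in> Hom C A D"
    and Comp_assoc:
      "\<lbrakk>f \<in> Hom C A B; g \<in> Hom C B D; h \<in> Hom C D F\<rbrakk> \<Longrightarrow> (h \<cdot> g) \<cdot> f = h \<cdot> (g \<cdot> f)"
    and Comp_Id: "f \<in> Hom C A B \<Longrightarrow> f \<cdot> Id C A = f"
    and Id_Comp: "f \<in> Hom C A B \<Longrightarrow> Id C B \<cdot> f = f"
    and comm_group_Hom: "\<lbrakk>A \<in> Obj C; B \<in> Obj C\<rbrakk> \<Longrightarrow> comm_group (hom_group C A B)"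
    and Comp_Add:
      "\<lbrakk>f \<in> Hom C A B; f' \<in> Hom C A B; g \<in> Hom C B D\<rbrakk>
        \<Longrightarrow> g \<cdot> (f \<boxplus> f') = (g \<cdot> f) \<boxplus> (g \<cdot> f')"
    and Add_Comp:
      "\<lbrakk>f \<in> Hom C A B; g \<in> Hom C B D; g' \<in> Hom C B D\<rbrakk>
        \<Longrightarrow> (g \<boxplus> g') \<cdot> f = (g \<cdot> f) \<boxplus> (g' \<cdot> f)"

definition is_mono :: "('o, 'm, 'z) preadditive_data_scheme \<Rightarrow> 'm \<Rightarrow> bool" where
  "is_mono C f \<longleftrightarrow> f \<in> Arr C \<and>
    (\<forall>W. \<forall>g \<in> Hom C W (Dom C f). \<forall>h \<in> Hom C W (Dom C f).
      f \<cdot>\<^bsub>C\<^esub> g = f \<cdot>\<^bsub>C\<^esub> h \<longrightarrow> g = h)"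

definition is_epi :: "('o, 'm, 'z) preadditive_data_scheme \<Rightarrow> 'm \<Rightarrow> bool" where
  "is_epi C f \<longleftrightarrow> f \<in> Arr C \<and>
    (\<forall>W. \<forall>g \<in> Hom C (Cod C f) W. \<forall>h \<in> Hom C (Cod C f) W.
      g \<cdot>\<^bsub>C\<^esub> f = h \<cdot>\<^bsub>C\<^esub> f \<longrightarrow> g = h)"

definition is_iso :: "('o, 'm, 'z) preadditive_data_scheme \<Rightarrow> 'm \<Rightarrow> bool" where
  "is_iso C f \<longleftrightarrow> f \<in> Arr C \<and>
    (\<exists>g \<in> Hom C (Cod C f) (Dom C f).
      g \<cdot>\<^bsub>C\<^esub> f = Id C (Dom C f) \<and> f \<cdot>\<^bsub>C\<^esub> g = Id C (Cod C f))"

definition is_zero_object :: "('o, 'm, 'z) preadditive_data_scheme \<Rightarrow> 'o \<Rightarrow> bool" where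
  "is_zero_object C Z \<longleftrightarrow> Z \<in> Obj C \<and>
    (\<forall>A \<in> Obj C. (\<exists>!f. f \<in> Hom C A Z) \<and> (\<exists>!f. f \<in> Hom C Z A))"

definition is_biproduct ::
  "('o, 'm, 'z) preadditive_data_scheme \<Rightarrow> 'o \<Rightarrow> 'o \<Rightarrow> 'o \<Rightarrow> bool" where
  "is_biproduct C A B S \<longleftrightarrow> A \<in> Obj C \<and> B \<in> Obj C \<and> S \<in> Obj C \<and>
    (\<exists>i \<in> Hom C A S. \<exists>j \<in> Hom C B S. \<exists>p \<in> Hom C S A. \<exists>q \<in> Hom C S B.
      p \<cdot>\<^bsub>C\<^esub> i = Id C A \<and> q \<cdot>\<^bsub>C\<^esub> j = Id C B \<and>
      q \<cdot>\<^bsub>C\<^esub> i = Zero C A B \<and> p \<cdot>\<^bsub>C\<^esub> j = Zero C B A \<and>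
      (i \<cdot>\<^bsub>C\<^esub> p) \<boxplus>\<^bsub>C\<^esub> (j \<cdot>\<^bsub>C\<^esub> q) = Id C S)"

text \<open>A kernel of \<open>f\<close> is a morphism \<open>k\<close>; the object \<open>Ker f\<close> is its domain. Dually for cokernels.\<close>

definition is_kernel :: "('o, 'm, 'z) preadditive_data_scheme \<Rightarrow> 'm \<Rightarrow> 'm \<Rightarrow> bool" where
  "is_kernel C k f \<longleftrightarrow> f \<in> Arr C \<and> k \<in> Arr C \<and> Cod C k = Dom C f \<and>
    f \<cdot>\<^bsub>C\<^esub> k = Zero C (Dom C k) (Cod C f) \<and>
    (\<forall>W. \<forall>g \<in> Hom C W (Dom C f). f \<cdot>\<^bsub>C\<^esub> g = Zero C W (Cod C f) \<longrightarrow>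
      (\<exists>!u. u \<in> Hom C W (Dom C k) \<and> k \<cdot>\<^bsub>C\<^esub> u = g))"

definition is_cokernel :: "('o, 'm, 'z) preadditive_data_scheme \<Rightarrow> 'm \<Rightarrow> 'm \<Rightarrow> bool" where
  "is_cokernel C c f \<longleftrightarrow> f \<in> Arr C \<and> c \<in> Arr C \<and> Dom C c = Cod C f \<and>
    c \<cdot>\<^bsub>C\<^esub> f = Zero C (Dom C f) (Cod C c) \<and>
    (\<forall>W. \<forall>g \<in> Hom C (Cod C f) W. g \<cdot>\<^bsub>C\<^esub> f = Zero C (Dom C f) W \<longrightarrow>
      (\<exists>!u. u \<in> Hom C (Cod C c) W \<and> u \<cdot>\<^bsub>C\<^esub> c = g))"

locale abelian_category = preadditive_category +
  assumes ex_zero_object: "\<exists>Z. is_zero_object C Z"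
    and ex_biproduct: "\<lbrakk>A \<in> Obj C; B \<in> Obj C\<rbrakk> \<Longrightarrow> \<exists>S. is_biproduct C A B S"
    and ex_kernel: "f \<in> Arr C \<Longrightarrow> \<exists>k. is_kernel C k f"
    and ex_cokernel: "f \<in> Arr C \<Longrightarrow> \<exists>c. is_cokernel C c f"
    and mono_is_kernel: "is_mono C f \<Longrightarrow> \<exists>g. is_kernel C f g"
    and epi_is_cokernel: "is_epi C f \<Longrightarrow> \<exists>g. is_cokernel C f g"

text \<open>\<open>is_pushout C i g i' g'\<close>: the square \<open>g' i = i' g\<close> is a push-out of \<open>i\<close> along \<open>g\<close>, with \<open>i'\<close>
  opposite to \<open>i\<close>. Similarly \<open>is_pullback C p g p' g'\<close>: the square \<open>p g' = g p'\<close> is a pull-back of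
  \<open>p\<close> along \<open>g\<close>, with \<open>p'\<close> opposite to \<open>p\<close>.\<close>

definition is_pushout ::
  "('o, 'm, 'z) preadditive_data_scheme \<Rightarrow> 'm \<Rightarrow> 'm \<Rightarrow> 'm \<Rightarrow> 'm \<Rightarrow> bool" where
  "is_pushout C i g i' g' \<longleftrightarrow> {i, g, i', g'} \<subseteq> Arr C \<and>
    Dom C i = Dom C g \<and> Dom C g' = Cod C i \<and> Dom C i' = Cod C g \<and> Cod C g' = Cod C i' \<and>
    g' \<cdot>\<^bsub>C\<^esub> i = i' \<cdot>\<^bsub>C\<^esub> g \<and>
    (\<forall>W. \<forall>a \<in> Hom C (Cod C i) W. \<forall>b \<in> Hom C (Cod C g) W.
      a \<cdot>\<^bsub>C\<^esub> i = b \<cdot>\<^bsub>C\<^esub> g \<longrightarrow>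
      (\<exists>!u. u \<in> Hom C (Cod C i') W \<and> u \<cdot>\<^bsub>C\<^esub> g' = a \<and> u \<cdot>\<^bsub>C\<^esub> i' = b))"

definition is_pullback ::
  "('o, 'm, 'z) preadditive_data_scheme \<Rightarrow> 'm \<Rightarrow> 'm \<Rightarrow> 'm \<Rightarrow> 'm \<Rightarrow> bool" where
  "is_pullback C p g p' g' \<longleftrightarrow> {p, g, p', g'} \<subseteq> Arr C \<and>
    Cod C p = Cod C g \<and> Cod C g' = Dom C p \<and> Cod C p' = Dom C g \<and> Dom C g' = Dom C p' \<and>
    p \<cdot>\<^bsub>C\<^esub> g' = g \<cdot>\<^bsub>C\<^esub> p' \<and>
    (\<forall>W. \<forall>a \<in> Hom C W (Dom C p). \<forall>b \<in> Hom C W (Dom C g).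
      p \<cdot>\<^bsub>C\<^esub> a = g \<cdot>\<^bsub>C\<^esub> b \<longrightarrow>
      (\<exists>!u. u \<in> Hom C W (Dom C p') \<and> g' \<cdot>\<^bsub>C\<^esub> u = a \<and> p' \<cdot>\<^bsub>C\<^esub> u = b))"

section \<open>Exact structures\<close>

definition kernel_cokernel_pair ::
  "('o, 'm, 'z) preadditive_data_scheme \<Rightarrow> 'm \<Rightarrow> 'm \<Rightarrow> bool" where
  "kernel_cokernel_pair C i p \<longleftrightarrow> is_kernel C i p \<and> is_cokernel C p i"

definition isomorphic_pairs ::
  "('o, 'm, 'z) preadditive_data_scheme \<Rightarrow> 'm \<times> 'm \<Rightarrow> 'm \<times> 'm \<Rightarrow> bool" where
  "isomorphic_pairs C = (\<lambda>(i, p) (i', p').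
    {i, p, i', p'} \<subseteq> Arr C \<and> Cod C i = Dom C p \<and> Cod C i' = Dom C p' \<and>
    (\<exists>a b c. is_iso C a \<and> is_iso C b \<and> is_iso C c \<and>
      a \<in> Hom C (Dom C i) (Dom C i') \<and> b \<in> Hom C (Cod C i) (Cod C i') \<and>
      c \<in> Hom C (Cod C p) (Cod C p') \<and>
      b \<cdot>\<^bsub>C\<^esub> i = i' \<cdot>\<^bsub>C\<^esub> a \<and> c \<cdot>\<^bsub>C\<^esub> p = p' \<cdot>\<^bsub>C\<^esub> b))"

abbreviation admissible_monic :: "('m \<times> 'm) set \<Rightarrow> 'm \<Rightarrow> bool" where
  "admissible_monic E i \<equiv> \<exists>p. (i, p) \<in> E"

abbreviation admissible_epic :: "('m \<times> 'm) set \<Rightarrow> 'm \<Rightarrow> bool" where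
  "admissible_epic E p \<equiv> \<exists>i. (i, p) \<in> E"

locale exact_structure =
  fixes C :: "('o, 'm, 'z) preadditive_data_scheme" (structure) and E :: "('m \<times> 'm) set"
  assumes conflation_pair: "(i, p) \<in> E \<Longrightarrow> kernel_cokernel_pair C i p"
    and iso_closed: "\<lbrakk>(i, p) \<in> E; isomorphic_pairs C (i, p) (i', p')\<rbrakk> \<Longrightarrow> (i', p') \<in> E"
    and Id_admissible_monic: "A \<in> Obj C \<Longrightarrow> admissible_monic E (Id C A)"
    and Id_admissible_epic: "A \<in> Obj C \<Longrightarrow> admissible_epic E (Id C A)"
    and Comp_admissible_monic:
      "\<lbrakk>admissible_monic E i; admissible_monic E j; Cod C i = Dom C j\<rbrakk>
        \<Longrightarrow> admissible_monic E (j \<cdot> i)"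
    and Comp_admissible_epic:
      "\<lbrakk>admissible_epic E p; admissible_epic E q; Cod C p = Dom C q\<rbrakk>
        \<Longrightarrow> admissible_epic E (q \<cdot> p)"
    and ex_pushout:
      "\<lbrakk>admissible_monic E i; g \<in> Arr C; Dom C g = Dom C i\<rbrakk> \<Longrightarrow> \<exists>i' g'. is_pushout C i g i' g'"
    and pushout_admissible_monic:
      "\<lbrakk>admissible_monic E i; is_pushout C i g i' g'\<rbrakk> \<Longrightarrow> admissible_monic E i'"
    and ex_pullback:
      "\<lbrakk>admissible_epic E p; g \<in> Arr C; Cod C g = Cod C p\<rbrakk> \<Longrightarrow> \<exists>p' g'. is_pullback C p g p' g'"
    and pullback_admissible_epic:
      "\<lbrakk>admissible_epic E p; is_pullback C p g p' g'\<rbrakk> \<Longrightarrow> admissible_epic E p'"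

definition E_projective ::
  "('o, 'm, 'z) preadditive_data_scheme \<Rightarrow> ('m \<times> 'm) set \<Rightarrow> 'o \<Rightarrow> bool" where
  "E_projective C E P \<longleftrightarrow> P \<in> Obj C \<and>
    (\<forall>p. admissible_epic E p \<longrightarrow>
      (\<forall>g \<in> Hom C P (Cod C p). \<exists>h \<in> Hom C P (Dom C p). p \<cdot>\<^bsub>C\<^esub> h = g))"

definition E_injective ::
  "('o, 'm, 'z) preadditive_data_scheme \<Rightarrow> ('m \<times> 'm) set \<Rightarrow> 'o \<Rightarrow> bool" where
  "E_injective C E I \<longleftrightarrow> I \<in> Obj C \<and>
    (\<forall>i. admissible_monic E i \<longrightarrow>
      (\<forall>g \<in> Hom C (Dom C i) I. \<exists>h \<in> Hom C (Cod C i) I. h \<cdot>\<^bsub>C\<^esub> i = g))"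

definition enough_E_projectives ::
  "('o, 'm, 'z) preadditive_data_scheme \<Rightarrow> ('m \<times> 'm) set \<Rightarrow> bool" where
  "enough_E_projectives C E \<longleftrightarrow>
    (\<forall>M \<in> Obj C. \<exists>p. admissible_epic E p \<and> Cod C p = M \<and> E_projective C E (Dom C p))"

definition enough_E_injectives ::
  "('o, 'm, 'z) preadditive_data_scheme \<Rightarrow> ('m \<times> 'm) set \<Rightarrow> bool" where
  "enough_E_injectives C E \<longleftrightarrow>
    (\<forall>M \<in> Obj C. \<exists>i. admissible_monic E i \<and> Dom C i = M \<and> E_injective C E (Cod C i))"

section \<open>Ext groups relative to an exact structure\<close>

text \<open>
  \<open>\<dots> \<rightarrow> P 2 \<rightarrow> P 1 \<rightarrow> P 0\<close> with differentials \<open>d n : P (n + 1) \<rightarrow> P n\<close> is spliced from conflations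
  \<open>K (n + 1) \<rightarrow> P n \<rightarrow> K n\<close>, where \<open>K 0 = M\<close>. The augmentation \<open>p 0 : P 0 \<rightarrow> M\<close> is not recorded,
  since it does not enter the computation of the cohomology.
\<close>

definition E_projective_resolution ::
  "('o, 'm, 'z) preadditive_data_scheme \<Rightarrow> ('m \<times> 'm) set \<Rightarrow> 'o
    \<Rightarrow> (nat \<Rightarrow> 'o) \<times> (nat \<Rightarrow> 'm) \<Rightarrow> bool" where
  "E_projective_resolution C E M = (\<lambda>(P, d).
    \<exists>K i p. K 0 = M \<and>
      (\<forall>n. E_projective C E (P n) \<and> (i n, p n) \<in> E \<and>
        i n \<in> Hom C (K (Suc n)) (P n) \<and> p n \<in> Hom C (P n) (K n) \<and>
        d n = i n \<cdot>\<^bsub>C\<^esub> p (Suc n)))"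

text \<open>
  Cohomology at \<open>Hom (P n) N\<close>, for \<open>n \<ge> 1\<close>, of the complex obtained by applying \<open>Hom (_) N\<close>.
\<close>

definition Hom_cohomology ::
  "('o, 'm, 'z) preadditive_data_scheme \<Rightarrow> (nat \<Rightarrow> 'o) \<times> (nat \<Rightarrow> 'm) \<Rightarrow> 'o \<Rightarrow> nat
    \<Rightarrow> 'm set monoid" where
  "Hom_cohomology C = (\<lambda>(P, d) N n.
    (hom_group C (P n) N)
      \<lparr>carrier := kernel (hom_group C (P n) N) (hom_group C (P (Suc n)) N) (\<lambda>g. g \<cdot>\<^bsub>C\<^esub> d n)\<rparr>
    Mod ((\<lambda>h. h \<cdot>\<^bsub>C\<^esub> d (n - 1)) ` Hom C (P (n - 1)) N))"

text \<open>
  The group does not depend, up to isomorphism, on the resolution of the first argument, which is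
  fixed by choice. With enough projectives such a resolution exists for every object. The degree is
  meant to be at least 1.
\<close>

definition Ext_group ::
  "('o, 'm, 'z) preadditive_data_scheme \<Rightarrow> ('m \<times> 'm) set \<Rightarrow> nat \<Rightarrow> 'o \<Rightarrow> 'o \<Rightarrow> 'm set monoid" where
  "Ext_group C E n M N = Hom_cohomology C (SOME R. E_projective_resolution C E M R) N n"

definition right_orthogonal ::
  "('o, 'm, 'z) preadditive_data_scheme \<Rightarrow> ('m \<times> 'm) set \<Rightarrow> 'o set \<Rightarrow> 'o set" where
  "right_orthogonal C E X = {N \<in> Obj C. \<forall>M \<in> X. trivial_group (Ext_group C E 1 M N)}"

definition left_orthogonal ::
  "('o, 'm, 'z) preadditive_data_scheme \<Rightarrow> ('m \<times> 'm) set \<Rightarrow> 'o set \<Rightarrow> 'o set" where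
  "left_orthogonal C E X = {M \<in> Obj C. \<forall>N \<in> X. trivial_group (Ext_group C E 1 M N)}"

section \<open>Subcategories, covers and envelopes\<close>

text \<open>
  A full subcategory is given by its class of objects; it is additive and closed under isomorphisms
  and direct summands.
\<close>

definition is_subcategory :: "('o, 'm, 'z) preadditive_data_scheme \<Rightarrow> 'o set \<Rightarrow> bool" where
  "is_subcategory C X \<longleftrightarrow> X \<subseteq> Obj C \<and>
    (\<exists>Z \<in> X. is_zero_object C Z) \<and>
    (\<forall>A \<in> X. \<forall>B \<in> X. \<forall>S. is_biproduct C A B S \<longrightarrow> S \<in> X) \<and>
    (\<forall>f. is_iso C f \<and> Dom C f \<in> X \<longrightarrow> Cod C f \<in> X) \<and>
    (\<forall>A B S. is_biproduct C A B S \<and> S \<in> X \<longrightarrow> A \<in> X)"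

definition closed_under_E_extensions ::
  "('o, 'm, 'z) preadditive_data_scheme \<Rightarrow> ('m \<times> 'm) set \<Rightarrow> 'o set \<Rightarrow> bool" where
  "closed_under_E_extensions C E X \<longleftrightarrow>
    (\<forall>i p. (i, p) \<in> E \<and> Dom C i \<in> X \<and> Cod C p \<in> X \<longrightarrow> Cod C i \<in> X)"

definition is_precover ::
  "('o, 'm, 'z) preadditive_data_scheme \<Rightarrow> 'o set \<Rightarrow> 'o \<Rightarrow> 'm \<Rightarrow> bool" where
  "is_precover C X A f \<longleftrightarrow> f \<in> Arr C \<and> Dom C f \<in> X \<and> Cod C f = A \<and>
    (\<forall>X' \<in> X. \<forall>g \<in> Hom C X' A. \<exists>h \<in> Hom C X' (Dom C f). f \<cdot>\<^bsub>C\<^esub> h = g)"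

definition is_cover ::
  "('o, 'm, 'z) preadditive_data_scheme \<Rightarrow> 'o set \<Rightarrow> 'o \<Rightarrow> 'm \<Rightarrow> bool" where
  "is_cover C X A f \<longleftrightarrow> is_precover C X A f \<and>
    (\<forall>h \<in> Hom C (Dom C f) (Dom C f). f = f \<cdot>\<^bsub>C\<^esub> h \<longrightarrow> is_iso C h)"

definition is_preenvelope ::
  "('o, 'm, 'z) preadditive_data_scheme \<Rightarrow> 'o set \<Rightarrow> 'o \<Rightarrow> 'm \<Rightarrow> bool" where
  "is_preenvelope C X A f \<longleftrightarrow> f \<in> Arr C \<and> Dom C f = A \<and> Cod C f \<in> X \<and>
    (\<forall>X' \<in> X. \<forall>g \<in> Hom C A X'. \<exists>h \<in> Hom C (Cod C f) X'. h \<cdot>\<^bsub>C\<^esub> f = g)"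

definition is_envelope ::
  "('o, 'm, 'z) preadditive_data_scheme \<Rightarrow> 'o set \<Rightarrow> 'o \<Rightarrow> 'm \<Rightarrow> bool" where
  "is_envelope C X A f \<longleftrightarrow> is_preenvelope C X A f \<and>
    (\<forall>h \<in> Hom C (Cod C f) (Cod C f). f = h \<cdot>\<^bsub>C\<^esub> f \<longrightarrow> is_iso C h)"

end

theory Submission
  imports Defs
begin

text \<open>
  To show that \<open>\<E>xt\<^sup>1 (M, N) = 0\<close> it suffices to extend every \<open>g : K \<rightarrow> N\<close> along \<open>i\<close>, for every
  conflation \<open>K \<rightarrow> P \<rightarrow> M\<close> with maps \<open>i\<close> and \<open>p\<close>.

  For a cover \<open>f : X\<^sub>0 \<rightarrow> A\<close> with kernel \<open>k\<close>, \<open>M \<in> X\<close> and \<open>N = Ker f\<close>, push the conflation out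
  along \<open>k g\<close> to a conflation \<open>X\<^sub>0 \<rightarrow> Q \<rightarrow> M\<close>, whose middle term lies in \<open>X\<close>. The map \<open>Q \<rightarrow> A\<close> given by
  \<open>f\<close> on \<open>X\<^sub>0\<close> and by \<open>0\<close> on \<open>P\<close> lifts through \<open>f\<close>, and the cover property corrects the lift to a
  retraction \<open>r\<close> of \<open>X\<^sub>0 \<rightarrow> Q\<close> over \<open>A\<close>. On \<open>P\<close> it takes values in \<open>Ker f\<close> and extends \<open>g\<close>.

  For an envelope \<open>f : A \<rightarrow> X\<^sub>0\<close> with cokernel \<open>c\<close>, \<open>M = Coker f\<close> and \<open>N \<in> X\<close>, push out along \<open>g\<close>
  to \<open>N \<rightarrow> Q \<rightarrow> M\<close> and pull back along \<open>c\<close> to \<open>N \<rightarrow> R \<rightarrow> X\<^sub>0\<close>, so that \<open>R \<in> X\<close>. Dually one obtains a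
  section of \<open>R \<rightarrow> X\<^sub>0\<close> under \<open>A\<close>; it induces a section of \<open>Q \<rightarrow> M\<close>, so the push-out splits.
\<close>

lemma HomD:
  assumes "f \<in> Hom C A B"
  shows "f \<in> Arr C" "Dom C f = A" "Cod C f = B"
  using assms by (auto simp: Hom_def)

text \<open>The only coset is the whole carrier. This is the form in which \<open>Ext_group\<close>
  appears once every cocycle is known to be a coboundary.\<close>

lemma trivial_group_Mod_carrier:
  assumes "group G"
  shows "trivial_group (G Mod carrier G)"
proof -
  interpret group G by fact
  have "group (G Mod carrier G)" by (rule normal.factorgroup_is_group[OF normal_self])
  moreover have "carrier (G Mod carrier G) = {carrier G}"
    by (auto simp: FactGroup_def RCOSETS_def coset_join2 subgroup_self)
  ultimately show ?thesis by (simp add: trivial_group_def FactGroup_def)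
qed

section \<open>Kernels and cokernels in preadditive categories\<close>

context preadditive_category
begin

lemma Hom_in_Obj:
  assumes "f \<in> Hom C A B"
  shows "A \<in> Obj C" "B \<in> Obj C"
  using assms Dom_in_Obj Cod_in_Obj by (auto simp: Hom_def)

text \<open>Transfers the group axioms of \<open>hom_group\<close> to \<open>Add\<close> and
  \<open>Zero\<close>. The record has no negation, so inverses are given by an existence
  statement.\<close>

lemma
  assumes "A \<in> Obj C" "B \<in> Obj C"
  shows Zero_in_Hom: "Zero C A B \<in> Hom C A B"
    and Zero_if_idem: "\<And>x. \<lbrakk>x \<in> Hom C A B; x \<boxplus> x = x\<rbrakk> \<Longrightarrow> x = Zero C A B"
    and Add_Zero: "\<And>x. x \<in> Hom C A B \<Longrightarrow> x \<boxplus> Zero C A B = x"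
    and Zero_Add: "\<And>x. x \<in> Hom C A B \<Longrightarrow> Zero C A B \<boxplus> x = x"
    and Add_in_Hom: "\<And>x y. \<lbrakk>x \<in> Hom C A B; y \<in> Hom C A B\<rbrakk> \<Longrightarrow> x \<boxplus> y \<in> Hom C A B"
    and ex_Add_inverse: "\<And>x. x \<in> Hom C A B \<Longrightarrow> \<exists>y\<in>Hom C A B. x \<boxplus> y = Zero C A B"
proof -
  interpret G: comm_group "hom_group C A B" using comm_group_Hom assms .
  show "Zero C A B \<in> Hom C A B" using G.one_closed by (simp add: hom_group_def)
  show "x = Zero C A B" if "x \<in> Hom C A B" "x \<boxplus> x = x" for x
    using G.l_cancel_one'[of x x] that by (simp add: hom_group_def)
  show "x \<boxplus> Zero C A B = x" if "x \<in> Hom C A B" for x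
    using G.r_one[of x] that by (simp add: hom_group_def)
  show "Zero C A B \<boxplus> x = x" if "x \<in> Hom C A B" for x
    using G.l_one[of x] that by (simp add: hom_group_def)
  show "x \<boxplus> y \<in> Hom C A B" if "x \<in> Hom C A B" "y \<in> Hom C A B" for x y
    using G.m_closed[of x y] that by (simp add: hom_group_def)
  show "\<exists>y\<in>Hom C A B. x \<boxplus> y = Zero C A B" if "x \<in> Hom C A B" for x
    using G.r_inv[of x] G.inv_closed[of x] that by (auto simp: hom_group_def)
qed

text \<open>By additivity the composite equals its own double, and an idempotent of a group is the
  neutral element.\<close>

lemma Zero_Comp:
  assumes "f \<in> Hom C A B" "D \<in> Obj C"
  shows "Zero C B D \<cdot> f = Zero C A D"
proof -
  note o = Hom_in_Obj[OF assms(1)]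
  have z: "Zero C B D \<in> Hom C B D" using Zero_in_Hom o assms by blast
  have "Zero C B D \<cdot> f \<boxplus> Zero C B D \<cdot> f = Zero C B D \<cdot> f"
    using Add_Comp[OF assms(1) z z] Add_Zero[OF o(2) assms(2) z] by simp
  then show ?thesis
    using Zero_if_idem[OF o(1) assms(2)] Comp_in_Hom[OF assms(1) z] by blast
qed

lemma Comp_Zero:
  assumes "f \<in> Hom C B D" "A \<in> Obj C"
  shows "f \<cdot> Zero C A B = Zero C A D"
proof -
  note o = Hom_in_Obj[OF assms(1)]
  have z: "Zero C A B \<in> Hom C A B" using Zero_in_Hom o assms by blast
  have "f \<cdot> Zero C A B \<boxplus> f \<cdot> Zero C A B = f \<cdot> Zero C A B"
    using Comp_Add[OF z z assms(1)] Add_Zero[OF assms(2) o(1) z] by simp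
  then show ?thesis
    using Zero_if_idem[OF assms(2) o(2)] Comp_in_Hom[OF z assms(1)] by blast
qed

section \<open>Universal properties of kernels and cokernels\<close>

lemma kernel_Comp:
  assumes "is_kernel C k f" "f \<in> Hom C A B" "k \<in> Hom C K A"
  shows "f \<cdot> k = Zero C K B"
  using assms by (auto simp: is_kernel_def Hom_def)

lemma cokernel_Comp:
  assumes "is_cokernel C c f" "f \<in> Hom C A B" "c \<in> Hom C B D"
  shows "c \<cdot> f = Zero C A D"
  using assms by (auto simp: is_cokernel_def Hom_def)

lemma kernel_factor:
  assumes "is_kernel C k f" "f \<in> Hom C A B" "k \<in> Hom C K A"
    and "g \<in> Hom C W A" "f \<cdot> g = Zero C W B"
  obtains u where "u \<in> Hom C W K" "k \<cdot> u = g"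
  using assms unfolding is_kernel_def by (metis HomD(2) HomD(3))

lemma cokernel_factor:
  assumes "is_cokernel C c f" "f \<in> Hom C A B" "c \<in> Hom C B D"
    and "g \<in> Hom C B W" "g \<cdot> f = Zero C A W"
  obtains u where "u \<in> Hom C D W" "u \<cdot> c = g"
  using assms unfolding is_cokernel_def by (metis HomD(2) HomD(3))

text \<open>Kernels are monic: \<open>u\<close> and \<open>v\<close> both factor \<open>k u\<close>,
  which \<open>f\<close> kills, and such a factorization is unique.\<close>

lemma kernel_cancel:
  assumes k: "is_kernel C k f" "k \<in> Hom C K A"
    and uv: "u \<in> Hom C W K" "v \<in> Hom C W K" "k \<cdot> u = k \<cdot> v"
  shows "u = v"
proof -
  define B where "B = Cod C f"
  have f: "f \<in> Hom C A B" using k by (auto simp: is_kernel_def Hom_def B_def)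
  have "f \<cdot> (k \<cdot> u) = Zero C W B"
    using Comp_assoc[OF uv(1) k(2) f] kernel_Comp[OF k(1) f k(2)]
      Zero_Comp[OF uv(1)] Hom_in_Obj[OF f] by simp
  moreover have "k \<cdot> u \<in> Hom C W A" using Comp_in_Hom uv k by blast
  ultimately have "\<exists>!w. w \<in> Hom C W K \<and> k \<cdot> w = k \<cdot> u"
    using k f unfolding is_kernel_def by (metis HomD(2) HomD(3))
  then show ?thesis using uv by metis
qed

lemma cokernel_cancel:
  assumes c: "is_cokernel C c f" "c \<in> Hom C B D"
    and uv: "u \<in> Hom C D W" "v \<in> Hom C D W" "u \<cdot> c = v \<cdot> c"
  shows "u = v"
proof -
  define A where "A = Dom C f"
  have f: "f \<in> Hom C A B" using c by (auto simp: is_cokernel_def Hom_def A_def)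
  have "(u \<cdot> c) \<cdot> f = Zero C A W"
    using Comp_assoc[OF f c(2) uv(1)] cokernel_Comp[OF c(1) f c(2)]
      Comp_Zero[OF uv(1)] Hom_in_Obj[OF f] by simp
  moreover have "u \<cdot> c \<in> Hom C B W" using Comp_in_Hom uv c by blast
  ultimately have "\<exists>!w. w \<in> Hom C D W \<and> w \<cdot> c = u \<cdot> c"
    using c f unfolding is_cokernel_def by (metis HomD(2) HomD(3))
  then show ?thesis using uv by metis
qed

text \<open>Splits the unique existence in the definition into a factorization and a cancellation
  property.\<close>

lemma is_kernelI:
  assumes f: "f \<in> Hom C A B" and k: "k \<in> Hom C K A" and "f \<cdot> k = Zero C K B"
    and "\<And>W g. \<lbrakk>g \<in> Hom C W A; f \<cdot> g = Zero C W B\<rbrakk> \<Longrightarrow> \<exists>u\<in>Hom C W K. k \<cdot> u = g"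
    and "\<And>W u v. \<lbrakk>u \<in> Hom C W K; v \<in> Hom C W K; k \<cdot> u = k \<cdot> v\<rbrakk> \<Longrightarrow> u = v"
  shows "is_kernel C k f"
  unfolding is_kernel_def HomD[OF f] HomD[OF k] using assms(3) assms(4) assms(5) f k HomD(1) by metis

lemma is_cokernelI:
  assumes f: "f \<in> Hom C A B" and c: "c \<in> Hom C B D" and "c \<cdot> f = Zero C A D"
    and "\<And>W g. \<lbrakk>g \<in> Hom C B W; g \<cdot> f = Zero C A W\<rbrakk> \<Longrightarrow> \<exists>u\<in>Hom C D W. u \<cdot> c = g"
    and "\<And>W u v. \<lbrakk>u \<in> Hom C D W; v \<in> Hom C D W; u \<cdot> c = v \<cdot> c\<rbrakk> \<Longrightarrow> u = v"
  shows "is_cokernel C c f"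
  unfolding is_cokernel_def HomD[OF f] HomD[OF c] using assms(3) assms(4) assms(5) f c HomD(1) by metis

section \<open>Isomorphisms, and uniqueness of kernels and cokernels\<close>

lemma is_isoI:
  assumes "f \<in> Hom C A B" "g \<in> Hom C B A" "g \<cdot> f = Id C A" "f \<cdot> g = Id C B"
  shows "is_iso C f"
  using assms by (auto simp: is_iso_def Hom_def)

lemma is_isoE:
  assumes "is_iso C f" "f \<in> Hom C A B"
  obtains g where "g \<in> Hom C B A" "g \<cdot> f = Id C A" "f \<cdot> g = Id C B"
  using assms unfolding is_iso_def by (metis HomD(2) HomD(3))

lemma is_iso_Id: "A \<in> Obj C \<Longrightarrow> is_iso C (Id C A)"
  by (rule is_isoI[of _ A A "Id C A"]) (auto intro: Id_in_Hom Id_Comp)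

lemma cokernels_iso:
  assumes c: "is_cokernel C c f" "c \<in> Hom C B D"
    and c': "is_cokernel C c' f" "c' \<in> Hom C B D'"
  obtains u where "is_iso C u" "u \<in> Hom C D D'" "u \<cdot> c = c'"
proof -
  define A where "A = Dom C f"
  have f: "f \<in> Hom C A B" using c by (auto simp: is_cokernel_def Hom_def A_def)
  obtain u where u: "u \<in> Hom C D D'" "u \<cdot> c = c'"
    using cokernel_factor[OF c(1) f c(2) c'(2)] cokernel_Comp[OF c'(1) f c'(2)] .
  obtain v where v: "v \<in> Hom C D' D" "v \<cdot> c' = c"
    using cokernel_factor[OF c'(1) f c'(2) c(2)] cokernel_Comp[OF c(1) f c(2)] .
  have "v \<cdot> u = Id C D"
    by (rule cokernel_cancel[OF c])
      (use u v c Id_in_Hom Hom_in_Obj Comp_in_Hom Comp_assoc[OF c(2) u(1) v(1)] Id_Comp in auto)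
  moreover have "u \<cdot> v = Id C D'"
    by (rule cokernel_cancel[OF c'])
      (use u v c' Id_in_Hom Hom_in_Obj Comp_in_Hom Comp_assoc[OF c'(2) v(1) u(1)] Id_Comp in auto)
  ultimately show thesis using is_isoI u v that by blast
qed

lemma kernels_iso:
  assumes k: "is_kernel C k f" "k \<in> Hom C K A"
    and k': "is_kernel C k' f" "k' \<in> Hom C K' A"
  obtains u where "is_iso C u" "u \<in> Hom C K K'" "k' \<cdot> u = k"
proof -
  define B where "B = Cod C f"
  have f: "f \<in> Hom C A B" using k by (auto simp: is_kernel_def Hom_def B_def)
  obtain u where u: "u \<in> Hom C K K'" "k' \<cdot> u = k"
    using kernel_factor[OF k'(1) f k'(2) k(2)] kernel_Comp[OF k(1) f k(2)] .
  obtain v where v: "v \<in> Hom C K' K" "k \<cdot> v = k'"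
    using kernel_factor[OF k(1) f k(2) k'(2)] kernel_Comp[OF k'(1) f k'(2)] .
  have "v \<cdot> u = Id C K"
    by (rule kernel_cancel[OF k])
      (use u v k Id_in_Hom Hom_in_Obj Comp_in_Hom Comp_assoc[OF u(1) v(1) k(2)] Comp_Id in auto)
  moreover have "u \<cdot> v = Id C K'"
    by (rule kernel_cancel[OF k'])
      (use u v k' Id_in_Hom Hom_in_Obj Comp_in_Hom Comp_assoc[OF v(1) u(1) k'(2)] Comp_Id in auto)
  ultimately show thesis using is_isoI u v that by blast
qed

section \<open>Push-out and pull-back squares\<close>

lemma pushout_factor:
  assumes "is_pushout C i g i' g'"
    and "i \<in> Hom C K P" "g \<in> Hom C K N" "i' \<in> Hom C N Q"
    and "a \<in> Hom C P W" "b \<in> Hom C N W" "a \<cdot> i = b \<cdot> g"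
  obtains u where "u \<in> Hom C Q W" "u \<cdot> g' = a" "u \<cdot> i' = b"
  using assms unfolding is_pushout_def by (metis HomD(3))

text \<open>The two legs of a push-out are jointly epic: \<open>u\<close> and \<open>v\<close> are
  both mediating morphisms for the same cocone.\<close>

lemma pushout_cancel:
  assumes po: "is_pushout C i g i' g'"
    and h: "i \<in> Hom C K P" "g \<in> Hom C K N" "i' \<in> Hom C N Q" "g' \<in> Hom C P Q"
    and u: "u \<in> Hom C Q W" and v: "v \<in> Hom C Q W"
    and eq: "u \<cdot> g' = v \<cdot> g'" "u \<cdot> i' = v \<cdot> i'"
  shows "u = v"
proof -
  have sq: "g' \<cdot> i = i' \<cdot> g" using po by (simp add: is_pushout_def)
  have "(u \<cdot> g') \<cdot> i = (u \<cdot> i') \<cdot> g"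
    using Comp_assoc[OF h(1) h(4) u] Comp_assoc[OF h(2) h(3) u] sq by simp
  moreover have "u \<cdot> g' \<in> Hom C P W" "u \<cdot> i' \<in> Hom C N W" using Comp_in_Hom h u by blast+
  ultimately have "\<exists>!w. w \<in> Hom C Q W \<and> w \<cdot> g' = u \<cdot> g' \<and> w \<cdot> i' = u \<cdot> i'"
    using po h unfolding is_pushout_def by (metis HomD(3))
  then show ?thesis using u v eq by metis
qed

lemma pullback_factor:
  assumes "is_pullback C p g p' g'"
    and "p \<in> Hom C P M" "g \<in> Hom C N M" "p' \<in> Hom C Q N"
    and "a \<in> Hom C W P" "b \<in> Hom C W N" "p \<cdot> a = g \<cdot> b"
  obtains u where "u \<in> Hom C W Q" "g' \<cdot> u = a" "p' \<cdot> u = b"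
  using assms unfolding is_pullback_def by (metis HomD(2))

lemma pullback_cancel:
  assumes pb: "is_pullback C p g p' g'"
    and h: "p \<in> Hom C P M" "g \<in> Hom C N M" "p' \<in> Hom C Q N" "g' \<in> Hom C Q P"
    and u: "u \<in> Hom C W Q" and v: "v \<in> Hom C W Q"
    and eq: "g' \<cdot> u = g' \<cdot> v" "p' \<cdot> u = p' \<cdot> v"
  shows "u = v"
proof -
  have sq: "p \<cdot> g' = g \<cdot> p'" using pb by (simp add: is_pullback_def)
  have "p \<cdot> (g' \<cdot> u) = g \<cdot> (p' \<cdot> u)"
    using Comp_assoc[OF u h(4) h(1)] Comp_assoc[OF u h(3) h(2)] sq by simp
  moreover have "g' \<cdot> u \<in> Hom C W P" "p' \<cdot> u \<in> Hom C W N" using Comp_in_Hom h u by blast+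
  ultimately have "\<exists>!w. w \<in> Hom C W Q \<and> g' \<cdot> w = g' \<cdot> u \<and> p' \<cdot> w = p' \<cdot> u"
    using pb h unfolding is_pullback_def by (metis HomD(2))
  then show ?thesis using u v eq by metis
qed

text \<open>A push-out keeps the cokernel object. The map \<open>q\<close> is \<open>p\<close> on
  \<open>P\<close> and zero on \<open>N\<close>; a morphism killing \<open>i'\<close> restricts on
  \<open>P\<close> to one killing \<open>i\<close>, hence factors through \<open>p\<close>.\<close>

lemma pushout_cokernel:
  assumes po: "is_pushout C i g i' g'" and co: "is_cokernel C p i"
    and h: "i \<in> Hom C K P" "g \<in> Hom C K N" "i' \<in> Hom C N Q" "g' \<in> Hom C P Q" "p \<in> Hom C P M"
  obtains q where "q \<in> Hom C Q M" "q \<cdot> g' = p" "is_cokernel C q i'"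
proof -
  have sq: "g' \<cdot> i = i' \<cdot> g" using po by (simp add: is_pushout_def)
  have M: "M \<in> Obj C" and N: "N \<in> Obj C" using Hom_in_Obj h by blast+
  have pi: "p \<cdot> i = Zero C N M \<cdot> g"
    using cokernel_Comp[OF co h(1) h(5)] Zero_Comp[OF h(2) M] by simp
  obtain q where q: "q \<in> Hom C Q M" "q \<cdot> g' = p" "q \<cdot> i' = Zero C N M"
    using pushout_factor[OF po h(1-3) h(5) Zero_in_Hom[OF N M] pi] .
  have "is_cokernel C q i'"
  proof (rule is_cokernelI[OF h(3) q(1) q(3)])
    fix W a assume a: "a \<in> Hom C Q W" "a \<cdot> i' = Zero C N W"
    have W: "W \<in> Obj C" using Hom_in_Obj a by blast
    have "(a \<cdot> g') \<cdot> i = (a \<cdot> i') \<cdot> g"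
      using Comp_assoc[OF h(1) h(4) a(1)] Comp_assoc[OF h(2) h(3) a(1)] sq by simp
    then have "(a \<cdot> g') \<cdot> i = Zero C K W" using a Zero_Comp[OF h(2) W] by simp
    then obtain u where u: "u \<in> Hom C M W" "u \<cdot> p = a \<cdot> g'"
      using cokernel_factor[OF co h(1) h(5) Comp_in_Hom[OF h(4) a(1)]] by blast
    have "u \<cdot> q = a"
    proof (rule pushout_cancel[OF po h(1-4)])
      show "u \<cdot> q \<in> Hom C Q W" using Comp_in_Hom q u by blast
      show "(u \<cdot> q) \<cdot> g' = a \<cdot> g'" using Comp_assoc[OF h(4) q(1) u(1)] q u by simp
      show "(u \<cdot> q) \<cdot> i' = a \<cdot> i'"
        using Comp_assoc[OF h(3) q(1) u(1)] q a Comp_Zero[OF u(1) N] by simp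
    qed fact
    then show "\<exists>u\<in>Hom C M W. u \<cdot> q = a" using u by blast
  next
    fix W u v assume uv: "u \<in> Hom C M W" "v \<in> Hom C M W" "u \<cdot> q = v \<cdot> q"
    then have "u \<cdot> p = v \<cdot> p"
      using Comp_assoc[OF h(4) q(1) uv(1)] Comp_assoc[OF h(4) q(1) uv(2)] q by simp
    then show "u = v" using cokernel_cancel[OF co h(5)] uv by blast
  qed
  then show thesis using that q by blast
qed

text \<open>Dual to the push-out case: \<open>j\<close> has components \<open>i\<close> into
  \<open>P\<close> and zero into \<open>N\<close>.\<close>

lemma pullback_kernel:
  assumes pb: "is_pullback C p g p' g'" and ke: "is_kernel C i p"
    and h: "p \<in> Hom C P M" "g \<in> Hom C N M" "p' \<in> Hom C Q N" "g' \<in> Hom C Q P" "i \<in> Hom C K P"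
  obtains j where "j \<in> Hom C K Q" "g' \<cdot> j = i" "is_kernel C j p'"
proof -
  have sq: "p \<cdot> g' = g \<cdot> p'" using pb by (simp add: is_pullback_def)
  have K: "K \<in> Obj C" and N: "N \<in> Obj C" using Hom_in_Obj h by blast+
  have pi: "p \<cdot> i = g \<cdot> Zero C K N"
    using kernel_Comp[OF ke h(1) h(5)] Comp_Zero[OF h(2) K] by simp
  obtain j where j: "j \<in> Hom C K Q" "g' \<cdot> j = i" "p' \<cdot> j = Zero C K N"
    using pullback_factor[OF pb h(1-3) h(5) Zero_in_Hom[OF K N] pi] .
  have "is_kernel C j p'"
  proof (rule is_kernelI[OF h(3) j(1) j(3)])
    fix W a assume a: "a \<in> Hom C W Q" "p' \<cdot> a = Zero C W N"
    have W: "W \<in> Obj C" using Hom_in_Obj a by blast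
    have "p \<cdot> (g' \<cdot> a) = g \<cdot> (p' \<cdot> a)"
      using Comp_assoc[OF a(1) h(4) h(1)] Comp_assoc[OF a(1) h(3) h(2)] sq by simp
    then have "p \<cdot> (g' \<cdot> a) = Zero C W M" using a Comp_Zero[OF h(2) W] by simp
    then obtain u where u: "u \<in> Hom C W K" "i \<cdot> u = g' \<cdot> a"
      using kernel_factor[OF ke h(1) h(5) Comp_in_Hom[OF a(1) h(4)]] by blast
    have "j \<cdot> u = a"
    proof (rule pullback_cancel[OF pb h(1-4)])
      show "j \<cdot> u \<in> Hom C W Q" using Comp_in_Hom j u by blast
      show "g' \<cdot> (j \<cdot> u) = g' \<cdot> a" using Comp_assoc[OF u(1) j(1) h(4)] j u by simp
      show "p' \<cdot> (j \<cdot> u) = p' \<cdot> a"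
        using Comp_assoc[OF u(1) j(1) h(3)] j a Zero_Comp[OF u(1) N] by simp
    qed fact
    then show "\<exists>u\<in>Hom C W K. j \<cdot> u = a" using u by blast
  next
    fix W u v assume uv: "u \<in> Hom C W K" "v \<in> Hom C W K" "j \<cdot> u = j \<cdot> v"
    then have "i \<cdot> u = i \<cdot> v"
      using Comp_assoc[OF uv(1) j(1) h(4)] Comp_assoc[OF uv(2) j(1) h(4)] j by simp
    then show "u = v" using kernel_cancel[OF ke h(5)] uv by blast
  qed
  then show thesis using that j by blast
qed

end

section \<open>Push-outs and pull-backs of conflations\<close>

locale preadditive_exact = preadditive_category C + exact_structure C E
  for C :: "('o, 'm, 'z) preadditive_data_scheme" (structure) and E
begin

lemma conflationD:
  assumes "(i, p) \<in> E"
  shows "is_kernel C i p" "is_cokernel C p i"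
    "i \<in> Hom C (Dom C i) (Dom C p)" "p \<in> Hom C (Dom C p) (Cod C p)" "Cod C i = Dom C p"
  using conflation_pair[OF assms]
  by (auto simp: kernel_cokernel_pair_def is_kernel_def Hom_def)

text \<open>Two cokernels of \<open>i\<close> differ by an isomorphism, which together with
  identities on the first two terms is an isomorphism of pairs.\<close>

lemma conflation_cokernel:
  assumes E: "(i, p) \<in> E" and q: "is_cokernel C q i"
  shows "(i, q) \<in> E"
proof -
  note D = conflationD[OF E]
  have qH: "q \<in> Hom C (Dom C p) (Cod C q)"
    using q D(5) by (auto simp: is_cokernel_def Hom_def)
  obtain u where u: "is_iso C u" "u \<in> Hom C (Cod C p) (Cod C q)" "u \<cdot> p = q"
    using cokernels_iso[OF D(2) D(4) q qH] .
  have o: "Dom C i \<in> Obj C" "Dom C p \<in> Obj C" using Hom_in_Obj[OF D(3)] .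
  have "isomorphic_pairs C (i, p) (i, q)"
    unfolding isomorphic_pairs_def prod.case
    by (intro conjI exI[of _ "Id C (Dom C i)"] exI[of _ "Id C (Dom C p)"] exI[of _ u])
      (use is_iso_Id[OF o(1)] is_iso_Id[OF o(2)] Id_in_Hom[OF o(1)] Id_in_Hom[OF o(2)] u
        HomD[OF D(3)] HomD[OF D(4)] HomD[OF qH] Comp_Id[OF D(3)] Id_Comp[OF D(3)] Comp_Id[OF qH]
       in auto)
  then show ?thesis using iso_closed E by blast
qed

lemma conflation_kernel:
  assumes E: "(i, p) \<in> E" and j: "is_kernel C j p"
  shows "(j, p) \<in> E"
proof -
  note D = conflationD[OF E]
  have jH: "j \<in> Hom C (Dom C j) (Dom C p)"
    using j by (auto simp: is_kernel_def Hom_def)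
  obtain u where u: "is_iso C u" "u \<in> Hom C (Dom C i) (Dom C j)" "j \<cdot> u = i"
    using kernels_iso[OF D(1) D(3) j jH] .
  have o: "Dom C p \<in> Obj C" "Cod C p \<in> Obj C" using Hom_in_Obj[OF D(4)] .
  have "isomorphic_pairs C (i, p) (j, p)"
    unfolding isomorphic_pairs_def prod.case
    by (intro conjI exI[of _ u] exI[of _ "Id C (Dom C p)"] exI[of _ "Id C (Cod C p)"])
      (use is_iso_Id[OF o(1)] is_iso_Id[OF o(2)] Id_in_Hom[OF o(1)] Id_in_Hom[OF o(2)] u
        HomD[OF D(3)] HomD[OF D(4)] HomD[OF jH] Id_Comp[OF D(3)] Comp_Id[OF D(4)] Id_Comp[OF D(4)]
       in auto)
  then show ?thesis using iso_closed E by blast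
qed

text \<open>The axioms only make \<open>j\<close> an admissible monic with some cokernel
  \<open>r\<close>. Replacing \<open>r\<close> by the cokernel coming from the push-out square fixes
  the end term \<open>M\<close> and gives \<open>q g' = p\<close>.\<close>

lemma conflation_pushout:
  assumes E: "(i, p) \<in> E" and h: "i \<in> Hom C K P" "p \<in> Hom C P M" "g \<in> Hom C K N"
  obtains Q j g' q where "is_pushout C i g j g'" "j \<in> Hom C N Q" "g' \<in> Hom C P Q"
    "g' \<cdot> i = j \<cdot> g" "(j, q) \<in> E" "q \<in> Hom C Q M" "q \<cdot> g' = p"
proof -
  have "Dom C g = Dom C i" "g \<in> Arr C" using h by (auto simp: Hom_def)
  then obtain j g' where po: "is_pushout C i g j g'" using ex_pushout E by blast
  obtain r where r: "(j, r) \<in> E" using pushout_admissible_monic[OF _ po] E by blast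
  have H: "j \<in> Hom C N (Cod C j)" "g' \<in> Hom C P (Cod C j)" "g' \<cdot> i = j \<cdot> g"
    using po h by (auto simp: is_pushout_def Hom_def)
  obtain q where "q \<in> Hom C (Cod C j) M" "q \<cdot> g' = p" "is_cokernel C q j"
    using pushout_cokernel[OF po conflationD(2)[OF E] h(1) h(3) H(1,2) h(2)] .
  then show thesis using that po H conflation_cokernel[OF r] by blast
qed

lemma conflation_pullback:
  assumes E: "(i, p) \<in> E" and h: "i \<in> Hom C K P" "p \<in> Hom C P M" "g \<in> Hom C N M"
  obtains Q q g' j where "is_pullback C p g q g'" "q \<in> Hom C Q N" "g' \<in> Hom C Q P"
    "p \<cdot> g' = g \<cdot> q" "(j, q) \<in> E" "j \<in> Hom C K Q" "g' \<cdot> j = i"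
proof -
  have "Cod C g = Cod C p" "g \<in> Arr C" using h by (auto simp: Hom_def)
  then obtain q g' where pb: "is_pullback C p g q g'" using ex_pullback E by blast
  obtain r where r: "(r, q) \<in> E" using pullback_admissible_epic[OF _ pb] E by blast
  have H: "q \<in> Hom C (Dom C q) N" "g' \<in> Hom C (Dom C q) P" "p \<cdot> g' = g \<cdot> q"
    using pb h by (auto simp: is_pullback_def Hom_def)
  obtain j where "j \<in> Hom C K (Dom C q)" "g' \<cdot> j = i" "is_kernel C j q"
    using pullback_kernel[OF pb conflationD(1)[OF E] h(2) h(3) H(1,2) h(1)] .
  then show thesis using that pb H conflation_kernel[OF r] by blast
qed

section \<open>Vanishing of Ext\<close>

text \<open>Ensures that the \<open>SOME\<close> in \<open>Ext_group\<close> denotes an actual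
  resolution.\<close>

lemma ex_projective_resolution:
  assumes enough: "enough_E_projectives C E" and M: "M \<in> Obj C"
  shows "\<exists>R. E_projective_resolution C E M R"
proof -
  have "\<forall>L\<in>Obj C. \<exists>x. x \<in> E \<and> Cod C (snd x) = L \<and> E_projective C E (Dom C (snd x))"
    using enough unfolding enough_E_projectives_def by (metis snd_conv)
  then obtain s where s:
    "\<And>L. L \<in> Obj C \<Longrightarrow> s L \<in> E \<and> Cod C (snd (s L)) = L \<and> E_projective C E (Dom C (snd (s L)))"
    by metis
  \<comment> \<open>\<open>K n\<close> is the n-th syzygy: the kernel object of the conflation that
    \<open>s\<close> selects for the previous one.\<close>
  define K where "K = rec_nat M (\<lambda>_ L. Dom C (fst (s L)))"
  have K0: "K 0 = M" and KS: "\<And>n. K (Suc n) = Dom C (fst (s (K n)))" by (simp_all add: K_def)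
  have sE: "L \<in> Obj C \<Longrightarrow> (fst (s L), snd (s L)) \<in> E" for L using s by simp
  have KO: "K n \<in> Obj C" for n
  proof (induction n)
    case (Suc n)
    show ?case using Hom_in_Obj(1)[OF conflationD(3)[OF sE[OF Suc]]] KS by simp
  qed (simp add: K0 M)
  define i p where "i n = fst (s (K n))" and "p n = snd (s (K n))" for n
  have "E_projective C E (Dom C (p n)) \<and> (i n, p n) \<in> E \<and> i n \<in> Hom C (K (Suc n)) (Dom C (p n))
      \<and> p n \<in> Hom C (Dom C (p n)) (K n)" for n
    using s[OF KO[of n]] conflationD(3,4)[OF sE[OF KO[of n]]] KS[of n] by (simp add: i_def p_def)
  then have "E_projective_resolution C E M (\<lambda>n. Dom C (p n), \<lambda>n. i n \<cdot> p (Suc n))"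
    unfolding E_projective_resolution_def prod.case using K0 by blast
  then show ?thesis ..
qed

text \<open>A 1-cocycle on \<open>P 1\<close> factors through \<open>p 1\<close> as some
  \<open>g\<close> on the first syzygy; an extension of \<open>g\<close> to \<open>P 0\<close>
  exhibits it as a coboundary. The hypothesis ranges over all conflations ending in \<open>M\<close>
  because the resolution is an arbitrary choice.\<close>

lemma trivial_Ext1:
  assumes enough: "enough_E_projectives C E" and M: "M \<in> Obj C" and N: "N \<in> Obj C"
    and extend: "\<And>K P i p g. \<lbrakk>(i, p) \<in> E; i \<in> Hom C K P; p \<in> Hom C P M; g \<in> Hom C K N\<rbrakk>
      \<Longrightarrow> \<exists>h\<in>Hom C P N. h \<cdot> i = g"
  shows "trivial_group (Ext_group C E 1 M N)"
proof -
  define R where "R = (SOME R. E_projective_resolution C E M R)"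
  have "E_projective_resolution C E M R"
    unfolding R_def using ex_projective_resolution[OF enough M] by (rule someI_ex)
  moreover obtain P d where R: "R = (P, d)" by (cases R)
  ultimately obtain K i p where K0: "K 0 = M"
    and E: "\<And>n. (i n, p n) \<in> E"
    and i: "\<And>n. i n \<in> Hom C (K (Suc n)) (P n)" and p: "\<And>n. p n \<in> Hom C (P n) (K n)"
    and d: "\<And>n. d n = i n \<cdot> p (Suc n)"
    unfolding E_projective_resolution_def by auto
  have dH: "d n \<in> Hom C (P (Suc n)) (P n)" for n using d i p Comp_in_Hom by metis
  have PO: "P n \<in> Obj C" for n using Hom_in_Obj p by blast
  let ?G = "\<lambda>n. hom_group C (P n) N"
  \<comment> \<open>The 1-cocycles, written as in \<open>Hom_cohomology\<close> for degree 1 so that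
    the final unfolding matches.\<close>
  define Z where "Z = kernel (?G 1) (?G (Suc 1)) (\<lambda>g. g \<cdot> d 1)"
  interpret group_hom "?G 1" "?G (Suc 1)" "\<lambda>g. g \<cdot> d 1"
  proof (intro group_hom.intro group_hom_axioms.intro)
    show "group (?G 1)" "group (?G (Suc 1))"
      using comm_group_Hom[OF PO N] comm_group.axioms(2) by blast+
    show "(\<lambda>g. g \<cdot> d 1) \<in> hom (?G 1) (?G (Suc 1))"
      using Comp_in_Hom[OF dH[of 1]] Add_Comp[OF dH[of 1]]
      by (auto simp: hom_def hom_group_def)
  qed
  have "subgroup Z (?G 1)" unfolding Z_def by (rule subgroup_kernel)
  then have grp: "group (?G 1\<lparr>carrier := Z\<rparr>)"
    using G.is_group by (simp add: subgroup.subgroup_is_group)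
  have Z_iff: "x \<in> Z \<longleftrightarrow> x \<in> Hom C (P 1) N \<and> x \<cdot> d 1 = Zero C (P 2) N" for x
    by (simp add: Z_def kernel_def hom_group_def numeral_2_eq_2)
  have i1: "i 1 \<in> Hom C (K 2) (P 1)" and p2H: "p 2 \<in> Hom C (P 2) (K 2)"
    and p1: "p 1 \<in> Hom C (P 1) (K 1)" and i0: "i 0 \<in> Hom C (K 1) (P 0)"
    using i[of 1] i[of 0] p[of 1] p[of 2] by (simp_all add: numeral_2_eq_2)
  have d1: "d 1 = i 1 \<cdot> p 2" and d0: "d 0 = i 0 \<cdot> p 1" using d by (simp_all add: numeral_2_eq_2)
  \<comment> \<open>This vanishing is what makes coboundaries cocycles.\<close>
  have pi: "p 1 \<cdot> i 1 = Zero C (K 2) (K 1)"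
    using cokernel_Comp[OF conflationD(2)[OF E[of 1]] i1 p1] .
  have "(\<lambda>h. h \<cdot> d 0) ` Hom C (P 0) N = Z"
  proof (intro subset_antisym subsetI)
    fix x assume "x \<in> (\<lambda>h. h \<cdot> d 0) ` Hom C (P 0) N"
    then obtain h where h: "h \<in> Hom C (P 0) N" and x: "x = h \<cdot> d 0" by blast
    have hi: "h \<cdot> i 0 \<in> Hom C (K 1) N" using Comp_in_Hom i0 h by blast
    have xp: "x = (h \<cdot> i 0) \<cdot> p 1" using x d0 Comp_assoc[OF p1 i0 h] by simp
    then have xH: "x \<in> Hom C (P 1) N" using Comp_in_Hom p1 hi by blast
    have "x \<cdot> i 1 = Zero C (K 2) N"
      using xp Comp_assoc[OF i1 p1 hi] pi Comp_Zero[OF hi] Hom_in_Obj[OF i1] by simp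
    then have "x \<cdot> d 1 = Zero C (P 2) N"
      using d1 Comp_assoc[OF p2H i1 xH] Zero_Comp[OF p2H N] by simp
    then show "x \<in> Z" using Z_iff xH by blast
  next
    fix x assume "x \<in> Z"
    then have x: "x \<in> Hom C (P 1) N" "x \<cdot> d 1 = Zero C (P 2) N" using Z_iff by blast+
    \<comment> \<open>Since \<open>p 2\<close> is epic, \<open>x\<close> kills \<open>i 1\<close>
      itself and not merely \<open>d 1\<close>.\<close>
    have "(x \<cdot> i 1) \<cdot> p 2 = Zero C (K 2) N \<cdot> p 2"
      using d1 x Comp_assoc[OF p2H i1 x(1)] Zero_Comp[OF p2H N] by simp
    then have "x \<cdot> i 1 = Zero C (K 2) N"
      using cokernel_cancel[OF conflationD(2)[OF E[of 2]] p2H] Comp_in_Hom[OF i1 x(1)]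
        Zero_in_Hom[OF Hom_in_Obj(1)[OF i1] N] by blast
    then obtain g where g: "g \<in> Hom C (K 1) N" "g \<cdot> p 1 = x"
      using cokernel_factor[OF conflationD(2)[OF E[of 1]] i1 p1 x(1)] by blast
    \<comment> \<open>Only the conflation of index 0 ends in \<open>K 0 = M\<close>, where
      \<open>extend\<close> applies.\<close>
    obtain h where h: "h \<in> Hom C (P 0) N" "h \<cdot> i 0 = g"
      using extend[OF E[of 0] i0 _ g(1)] p[of 0] K0 by auto
    have "x = h \<cdot> d 0" using g h d0 Comp_assoc[OF p1 i0 h(1)] by simp
    then show "x \<in> (\<lambda>h. h \<cdot> d 0) ` Hom C (P 0) N" using h by blast
  qed
  then have "Ext_group C E 1 M N = ?G 1\<lparr>carrier := Z\<rparr> Mod carrier (?G 1\<lparr>carrier := Z\<rparr>)"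
    unfolding Ext_group_def R_def[symmetric] R Hom_cohomology_def Z_def by simp
  then show ?thesis using trivial_group_Mod_carrier[OF grp] by simp
qed

section \<open>Covers and envelopes\<close>

text \<open>The relative form of Wakamatsu's lemma, stated as an extension property.\<close>

lemma kernel_of_cover_extends:
  assumes ext: "closed_under_E_extensions C E X"
    and cover: "is_cover C X A f" and f: "f \<in> Hom C X0 A"
    and ker: "is_kernel C k f" and k: "k \<in> Hom C N X0" and M: "M \<in> X"
    and E: "(i, p) \<in> E" and i: "i \<in> Hom C K P" and p: "p \<in> Hom C P M" and g: "g \<in> Hom C K N"
  shows "\<exists>h\<in>Hom C P N. h \<cdot> i = g"
proof -
  have A: "A \<in> Obj C" and P: "P \<in> Obj C" using Hom_in_Obj f i by blast+
  have X0: "X0 \<in> X" using cover f by (auto simp: is_cover_def is_precover_def Hom_def)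
  have kg: "k \<cdot> g \<in> Hom C K X0" using Comp_in_Hom g k .
  obtain Q j b q where po: "is_pushout C i (k \<cdot> g) j b" and j: "j \<in> Hom C X0 Q"
    and b: "b \<in> Hom C P Q" and sq: "b \<cdot> i = j \<cdot> (k \<cdot> g)" and E': "(j, q) \<in> E"
    and q: "q \<in> Hom C Q M"
    using conflation_pushout[OF E i p kg] .
  have Q: "Q \<in> X"
    using ext E' X0 M HomD[OF j] HomD[OF q] unfolding closed_under_E_extensions_def by metis
  \<comment> \<open>Compatibility on \<open>K\<close> of zero on \<open>P\<close> with
    \<open>f\<close> on \<open>X0\<close>: both composites vanish because
    \<open>f k = 0\<close>.\<close>
  have "Zero C P A \<cdot> i = f \<cdot> (k \<cdot> g)"
    using Zero_Comp[OF i A] Comp_assoc[OF g k f] kernel_Comp[OF ker f k] Zero_Comp[OF g A] by simp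
  then obtain f' where f': "f' \<in> Hom C Q A" "f' \<cdot> b = Zero C P A" "f' \<cdot> j = f"
    using pushout_factor[OF po i kg j Zero_in_Hom[OF P A] f] by blast
  obtain t where t: "t \<in> Hom C Q X0" "f \<cdot> t = f'"
    using cover f f' Q unfolding is_cover_def is_precover_def by (metis HomD(2))
  have tj: "t \<cdot> j \<in> Hom C X0 X0" using Comp_in_Hom j t by blast
  have ftj: "f \<cdot> (t \<cdot> j) = f" using Comp_assoc[OF j t(1) f] t f' by simp
  then have "is_iso C (t \<cdot> j)"
    using cover tj HomD[OF f] unfolding is_cover_def by metis
  then obtain s where s: "s \<in> Hom C X0 X0" "s \<cdot> (t \<cdot> j) = Id C X0" "(t \<cdot> j) \<cdot> s = Id C X0"
    using is_isoE tj by metis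
  \<comment> \<open>The inverse of an automorphism over \<open>A\<close> is again over
    \<open>A\<close>, so correcting \<open>t\<close> by \<open>s\<close> does not change its
    composite with \<open>f\<close>.\<close>
  have fs: "f \<cdot> s = f"
    using Comp_assoc[OF s(1) tj f] ftj s Comp_Id[OF f] by simp
  define r where "r = s \<cdot> t"
  have r: "r \<in> Hom C Q X0" unfolding r_def using Comp_in_Hom s t by blast
  have rj: "r \<cdot> j = Id C X0" unfolding r_def using Comp_assoc[OF j t(1) s(1)] s by simp
  have fr: "f \<cdot> r = f'" unfolding r_def using Comp_assoc[OF t(1) s(1) f] fs t by simp
  have rb: "r \<cdot> b \<in> Hom C P X0" using Comp_in_Hom b r .
  have "f \<cdot> (r \<cdot> b) = Zero C P A" using Comp_assoc[OF b r f] fr f' by simp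
  then obtain u where u: "u \<in> Hom C P N" "k \<cdot> u = r \<cdot> b"
    using kernel_factor[OF ker f k rb] by blast
  \<comment> \<open>Here \<open>k u i = r b i = r j k g = k g\<close>, using the push-out square and
    \<open>r j = Id\<close>.\<close>
  have "k \<cdot> (u \<cdot> i) = k \<cdot> g"
    using Comp_assoc[OF i u(1) k] u Comp_assoc[OF i b r] sq Comp_assoc[OF kg j r] rj Id_Comp[OF kg]
    by simp
  then have "u \<cdot> i = g" using kernel_cancel[OF ker k Comp_in_Hom[OF i u(1)] g] by blast
  then show ?thesis using u by blast
qed

text \<open>The dual Wakamatsu argument. A conflation ending in \<open>M\<close> enters on the same
  side as before, so a pull-back follows the push-out and the splitting must be turned into an
  extension of \<open>g\<close>.\<close>

lemma cokernel_of_envelope_extends: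
  assumes ext: "closed_under_E_extensions C E X"
    and env: "is_envelope C X A f" and f: "f \<in> Hom C A X0"
    and cok: "is_cokernel C c f" and c: "c \<in> Hom C X0 M" and N: "N \<in> X"
    and E: "(i, p) \<in> E" and i: "i \<in> Hom C K P" and p: "p \<in> Hom C P M" and g: "g \<in> Hom C K N"
  shows "\<exists>h\<in>Hom C P N. h \<cdot> i = g"
proof -
  have A: "A \<in> Obj C" and P: "P \<in> Obj C" and K: "K \<in> Obj C" and MO: "M \<in> Obj C"
    using Hom_in_Obj f i c by blast+
  have X0: "X0 \<in> X" using env f by (auto simp: is_envelope_def is_preenvelope_def Hom_def)
  obtain Q j b q where j: "j \<in> Hom C N Q" and b: "b \<in> Hom C P Q" and sq: "b \<cdot> i = j \<cdot> g"
    and E': "(j, q) \<in> E" and q: "q \<in> Hom C Q M" and qb: "q \<cdot> b = p"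
    using conflation_pushout[OF E i p g] .
  obtain R q' c' j' where pb: "is_pullback C q c q' c'" and q': "q' \<in> Hom C R X0"
    and c': "c' \<in> Hom C R Q" and sq': "q \<cdot> c' = c \<cdot> q'" and E'': "(j', q') \<in> E"
    and j': "j' \<in> Hom C N R"
    using conflation_pullback[OF E' j q c] .
  have QO: "Q \<in> Obj C" using Hom_in_Obj q by blast
  have R: "R \<in> X"
    using ext E'' X0 N HomD[OF j'] HomD[OF q'] unfolding closed_under_E_extensions_def by metis
  \<comment> \<open>Since \<open>c f = 0\<close>, zero into \<open>Q\<close> and \<open>f\<close>
    into \<open>X0\<close> define a morphism \<open>a\<close> from \<open>A\<close> to the
    pull-back.\<close>
  have "q \<cdot> Zero C A Q = c \<cdot> f" using Comp_Zero[OF q A] cokernel_Comp[OF cok f c] by simp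
  then obtain a where a: "a \<in> Hom C A R" "c' \<cdot> a = Zero C A Q" "q' \<cdot> a = f"
    using pullback_factor[OF pb q c q' Zero_in_Hom[OF A QO] f] by blast
  obtain t where t: "t \<in> Hom C X0 R" "t \<cdot> f = a"
    using env f a R unfolding is_envelope_def is_preenvelope_def by (metis HomD(3))
  have qt: "q' \<cdot> t \<in> Hom C X0 X0" using Comp_in_Hom q' t by blast
  have qtf: "(q' \<cdot> t) \<cdot> f = f" using Comp_assoc[OF f t(1) q'] t a by simp
  then have "is_iso C (q' \<cdot> t)"
    using env qt HomD[OF f] unfolding is_envelope_def by metis
  then obtain s where s: "s \<in> Hom C X0 X0" "s \<cdot> (q' \<cdot> t) = Id C X0" "(q' \<cdot> t) \<cdot> s = Id C X0"
    using is_isoE qt by metis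
  have sf: "s \<cdot> f = f"
    using Comp_assoc[OF f qt s(1)] qtf s Id_Comp[OF f] by simp
  define r where "r = t \<cdot> s"
  have r: "r \<in> Hom C X0 R" unfolding r_def using Comp_in_Hom s t by blast
  have qr: "q' \<cdot> r = Id C X0" unfolding r_def using Comp_assoc[OF s(1) t(1) q'] s by simp
  have rf: "r \<cdot> f = a" unfolding r_def using Comp_assoc[OF f s(1) t(1)] sf t by simp
  have cr: "c' \<cdot> r \<in> Hom C X0 Q" using Comp_in_Hom r c' .
  have "(c' \<cdot> r) \<cdot> f = Zero C A Q" using Comp_assoc[OF f r c'] rf a by simp
  then obtain v where v: "v \<in> Hom C M Q" "v \<cdot> c = c' \<cdot> r"
    using cokernel_factor[OF cok f c cr] by blast
  \<comment> \<open>\<open>q v c = q c' r = c q' r = c\<close>, and the cokernel \<open>c\<close>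
    can be cancelled.\<close>
  have "(q \<cdot> v) \<cdot> c = Id C M \<cdot> c"
    using Comp_assoc[OF c v(1) q] v Comp_assoc[OF r c' q] sq' Comp_assoc[OF r q' c] qr
      Comp_Id[OF c] Id_Comp[OF c] by simp
  then have qv: "q \<cdot> v = Id C M"
    using cokernel_cancel[OF cok c] Comp_in_Hom[OF v(1) q] Id_in_Hom[OF MO] by blast
  \<comment> \<open>\<open>n\<close> plays the role of \<open>-p\<close>.\<close>
  obtain n where n: "n \<in> Hom C P M" "p \<boxplus> n = Zero C P M"
    using ex_Add_inverse[OF P MO p] by blast
  \<comment> \<open>\<open>b \<boxplus> v n\<close> is the difference \<open>b - v p\<close>, which \<open>q\<close> kills and which restricts to \<open>j g\<close> on \<open>K\<close>.\<close>
  have vn: "v \<cdot> n \<in> Hom C P Q" using Comp_in_Hom n v by blast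
  have bv: "b \<boxplus> v \<cdot> n \<in> Hom C P Q" using Add_in_Hom[OF P QO b vn] .
  have "q \<cdot> (b \<boxplus> v \<cdot> n) = Zero C P M"
    using Comp_Add[OF b vn q] qb Comp_assoc[OF n(1) v(1) q] qv Id_Comp[OF n(1)] n by simp
  then obtain w where w: "w \<in> Hom C P N" "j \<cdot> w = b \<boxplus> v \<cdot> n"
    using kernel_factor[OF conflationD(1)[OF E'] q j bv] by blast
  have pi: "p \<cdot> i = Zero C K M" using cokernel_Comp[OF conflationD(2)[OF E] i p] .
  \<comment> \<open>Restricting \<open>p + n = 0\<close> along \<open>i\<close> leaves
    \<open>n i\<close>, because \<open>p i = 0\<close>.\<close>
  have ni: "n \<cdot> i = Zero C K M"
    using Add_Comp[OF i p n(1)] n pi Zero_Comp[OF i MO] Zero_Add[OF K MO Comp_in_Hom[OF i n(1)]]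
    by simp
  have jg: "j \<cdot> g \<in> Hom C K Q" using Comp_in_Hom g j .
  have "j \<cdot> (w \<cdot> i) = j \<cdot> g"
    using Comp_assoc[OF i w(1) j] w Add_Comp[OF i b vn] sq Comp_assoc[OF i n(1) v(1)] ni
      Comp_Zero[OF v(1) K] Add_Zero[OF K QO jg] by simp
  then have "w \<cdot> i = g"
    using kernel_cancel[OF conflationD(1)[OF E'] j Comp_in_Hom[OF i w(1)] g] by blast
  then show ?thesis using w by blast
qed

end

theorem theorem3p3:
  fixes C :: "('o, 'm) preadditive_data"
    and E :: "('m \<times> 'm) set" and X :: "'o set" and A :: 'o
  assumes "abelian_category C"
    and "exact_structure C E"
    and "enough_E_projectives C E"
    and "enough_E_injectives C E"
    and "is_subcategory C X"
    and "closed_under_E_extensions C E X"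
    and "A \<in> Obj C"
  shows "(\<forall>f k. is_cover C X A f \<and> is_epi C f \<and> is_kernel C k f
            \<longrightarrow> Dom C k \<in> right_orthogonal C E X) \<and>
         (\<forall>f c. is_envelope C X A f \<and> is_mono C f \<and> is_cokernel C c f
            \<longrightarrow> Cod C c \<in> left_orthogonal C E X)"
proof -
  interpret preadditive_exact C E
    using assms(1,2) by (intro preadditive_exact.intro abelian_category.axioms)
  have XO: "X \<subseteq> Obj C" using assms(5) by (simp add: is_subcategory_def)
  have "Dom C k \<in> right_orthogonal C E X" if cover: "is_cover C X A f" and ker: "is_kernel C k f"
    for f k
  proof -
    have f: "f \<in> Hom C (Dom C f) A" and k: "k \<in> Hom C (Dom C k) (Dom C f)"
      using cover ker by (auto simp: is_cover_def is_precover_def is_kernel_def Hom_def)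
    have "trivial_group (Ext_group C E 1 M (Dom C k))" if "M \<in> X" for M
      using trivial_Ext1[OF assms(3)] kernel_of_cover_extends[OF assms(6) cover f ker k that]
        XO that Hom_in_Obj(1)[OF k] by blast
    then show ?thesis using Hom_in_Obj(1)[OF k] by (simp add: right_orthogonal_def)
  qed
  moreover have "Cod C c \<in> left_orthogonal C E X"
    if env: "is_envelope C X A f" and cok: "is_cokernel C c f" for f c
  proof -
    have f: "f \<in> Hom C A (Cod C f)" and c: "c \<in> Hom C (Cod C f) (Cod C c)"
      using env cok by (auto simp: is_envelope_def is_preenvelope_def is_cokernel_def Hom_def)
    have "trivial_group (Ext_group C E 1 (Cod C c) N)" if "N \<in> X" for N
      using trivial_Ext1[OF assms(3)] cokernel_of_envelope_extends[OF assms(6) env f cok c that]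
        XO that Hom_in_Obj(2)[OF c] by blast
    then show ?thesis using Hom_in_Obj(2)[OF c] by (simp add: left_orthogonal_def)
  qed
  ultimately show ?thesis by blast
qed

end
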